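(* Let $H$ be a polarised Hamiltonian of $\mathcal{H}$ with $k$ arguments, and suppose that $H$ is a quadratic polynomial in each of its arguments. Then the polarised AVF (PAVF) scheme $$\frac{U^{n+k}-U^{n}}{k\,\Delta t}=k\,D\,\frac{\delta H_{\mathrm{AVF}}}{\delta(U^{n},\dots,U^{n+k})},\qquad n\ge 0,$$ is linearly implicit.
   Context: Setting. Consider PDEs $u_t=\mathcal{D}\frac{\delta\mathcal{H}}{\delta u}$ for $u=(u^1,\dots,u^m)$ with values in $\mathbb{R}^m$, a function of time and of $x\in\Omega\subseteq\mathbb{R}^d$. Here $\mathcal{H}[u]=\int_\Omega \mathcal{G}[u]\,\mathrm{d}x$, where square brackets mean that $\mathcal{G}$ depends on $u$ and on finitely many of its partial derivatives $u_J^\alpha=\partial_J u^\alpha$ with respect to $x$. The variational derivative is defined by $\int_\Omega\frac{\delta\mathcal{H}}{\delta u}\cdot\varphi\,\mathrm{d}x=\frac{\partial}{\partial\epsilon}\big|_{\epsilon=0}\mathcal{H}[u+\epsilon\varphi]$ for all sufficiently smooth $\varphi$; its $\alpha$-component equals $\sum_{J}(-1)^{|J|}D_J\frac{\partial\mathcal{G}}{\partial u_J^\alpha}$, with $D_J$ the total derivative operator. The operator $\mathcal{D}$ may depend on $u$ and is skew-symmetric for the $L^2$ inner product, i.e. $\int_\Omega(\mathcal{D}v)\cdot w\,\mathrm{d}x=-\int_\Omega v\cdot(\mathcal{D}w)\,\mathrm{d}x$ for all $v,w$. Throughout, all functions are assumed sufficiently regular and the boundary conditions (e.g. periodic) are such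 that boundary terms vanish in integration by parts. Polarised Hamiltonian. A polarised Hamiltonian of $\mathcal{H}$ with $k$ arguments is a functional $H[w_1,\dots,w_k]=\int_\Omega G[w_1,\dots,w_k]\,\mathrm{d}x$ that is consistent, $H[u,u,\dots,u]=\mathcal{H}[u]$, and invariant under cyclic permutations of its arguments, $H[w_1,w_2,\dots,w_k]=H[w_2,\dots,w_k,w_1]$. "$H$ is a quadratic polynomial in each of its arguments" means: for each $i$, with the other arguments fixed, the density $G$ is a polynomial of degree at most two in $w_i$ and its partial derivatives (i.e. in the indeterminates $(w_i)_J^\alpha$). AVF discrete variational derivative of $H$: $$\frac{\delta H_{\mathrm{AVF}}}{\delta(w_1,\dots,w_{k+1})}=\int_0^1\frac{\delta H}{\delta w_1}[\xi w_{k+1}+(1-\xi)w_1,w_2,\dots,w_k]\,\mathrm{d}\xi,$$ where $\frac{\delta H}{\delta w_1}$ is the variational derivative of $H$ with respect to its first argument, the others being held fixed. Scheme. $\Delta t>0$ is the time step and $U^n=U^n(x)$ approximates the solution at time $n\Delta t$ (space is kept continuous). $D$ is a linear operator, skew-symmetric for the $L^2$ inner product, approximating $\mathcal{D}$; it may depend on $U^{n+1},\dots,U^{n+k-1}$ but not on $U^{n+k}$, and is consistent: $D[u,\dots,u]=\mathcal{D}[u]$. Linearly implicit. A scheme is linearly implicit if each time step requires the solution of precisely one linear system of equations, i.e. for given $U^{n},\dots,U^{n+k-1}$ the equation determining the new value $U^{n+k}$ is linear (affine) in $U^{n+k}$ (and its spatial derivatives). *)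

theory Defs
  imports "HOL-Analysis.Analysis"
begin

text \<open>
  A function on the open set \<open>\<Omega>\<close> is represented by its extension by zero to the whole space, so
  that two functions on \<open>\<Omega>\<close> agree iff their representations are equal.
\<close>

type_synonym ('d, 'm) field = "real ^ 'd \<Rightarrow> real ^ 'm"

definition partial :: "'d::finite \<Rightarrow> ('d, 'm::finite) field \<Rightarrow> ('d, 'm) field" where
  "partial i u = (\<lambda>x. frechet_derivative u (at x) (axis i 1))"

primrec partials :: "'d::finite list \<Rightarrow> ('d, 'm::finite) field \<Rightarrow> ('d, 'm) field" where
  "partials [] u = u"
| "partials (i # J) u = partial i (partials J u)"

text \<open>
  Multi-indices are tuples \<open>J = [j\<^sub>1, \<dots>, j\<^sub>s]\<close> of directions, and \<open>|J|\<close> is the length of \<open>J\<close>.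
  Tuples that differ by a permutation index the same derivative of a smooth function. A density may
  mention any of them, which does not change which functionals can be written.
\<close>

type_synonym ('d, 'm) jet = "'d list \<Rightarrow> real ^ 'm"

definition jet :: "('d::finite, 'm::finite) field \<Rightarrow> real ^ 'd \<Rightarrow> ('d, 'm) jet" where
  "jet u x = (\<lambda>J. partials J u x)"

definition Ck_on :: "nat \<Rightarrow> (real ^ 'd::finite) set \<Rightarrow> ('d, 'm::finite) field \<Rightarrow> bool" where
  "Ck_on r \<Omega> u \<longleftrightarrow>
     (\<forall>J. length J \<le> r \<longrightarrow> continuous_on \<Omega> (partials J u)) \<and>
     (\<forall>J. length J < r \<longrightarrow> partials J u differentiable_on \<Omega>)"

definition test_functions :: "(real ^ 'd::finite) set \<Rightarrow> ('d, 'm::finite) field set" where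
  "test_functions \<Omega> =
     {\<phi>. (\<forall>r. Ck_on r \<Omega> \<phi>) \<and> (\<exists>K. compact K \<and> K \<subseteq> \<Omega> \<and> (\<forall>x. x \<notin> K \<longrightarrow> \<phi> x = 0))}"

definition field_subspace :: "('d::finite, 'm::finite) field set \<Rightarrow> bool" where
  "field_subspace V \<longleftrightarrow>
     (\<lambda>x. 0) \<in> V \<and>
     (\<forall>u\<in>V. \<forall>v\<in>V. (\<lambda>x. u x + v x) \<in> V) \<and>
     (\<forall>c. \<forall>u\<in>V. (\<lambda>x. c *\<^sub>R u x) \<in> V)"

text \<open>
  \<open>V\<close> is the space of functions (states and variations) that are sufficiently regular and satisfy
  the boundary conditions. It contains all test functions, because no boundary condition is visible
  to a function that vanishes near the boundary.
\<close>

definition admissible_states ::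
  "nat \<Rightarrow> (real ^ 'd::finite) set \<Rightarrow> ('d, 'm::finite) field set \<Rightarrow> bool" where
  "admissible_states r \<Omega> V \<longleftrightarrow>
     field_subspace V \<and> test_functions \<Omega> \<subseteq> V \<and>
     (\<forall>u\<in>V. Ck_on r \<Omega> u \<and> (\<forall>x. x \<notin> \<Omega> \<longrightarrow> u x = 0))"

text \<open>
  \<open>Y\<close> is the space in which variational derivatives lie and on which the skew-symmetric operators
  act. It may equal \<open>V\<close> (for example for periodic functions), but a variational derivative
  need not satisfy the boundary conditions of the states.
\<close>

definition covector_space :: "(real ^ 'd::finite) set \<Rightarrow> ('d, 'm::finite) field set \<Rightarrow> bool" where
  "covector_space \<Omega> Y \<longleftrightarrow>
     field_subspace Y \<and> (\<forall>v\<in>Y. continuous_on \<Omega> v \<and> (\<forall>x. x \<notin> \<Omega> \<longrightarrow> v x = 0))"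

definition linear_operator ::
  "(real ^ 'd::finite) set \<Rightarrow> ('d, 'm::finite) field set \<Rightarrow> (('d, 'm) field \<Rightarrow> ('d, 'm) field) \<Rightarrow> bool"
where
  "linear_operator \<Omega> Y L \<longleftrightarrow>
     (\<forall>u\<in>Y. \<forall>v\<in>Y. \<forall>x\<in>\<Omega>. L (\<lambda>y. u y + v y) x = L u x + L v x) \<and>
     (\<forall>c. \<forall>u\<in>Y. \<forall>x\<in>\<Omega>. L (\<lambda>y. c *\<^sub>R u y) x = c *\<^sub>R L u x)"

definition affine_operator ::
  "(real ^ 'd::finite) set \<Rightarrow> ('d, 'm::finite) field set \<Rightarrow> (('d, 'm) field \<Rightarrow> ('d, 'm) field) \<Rightarrow> bool"
where
  "affine_operator \<Omega> V A \<longleftrightarrow>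
     (\<exists>L b. linear_operator \<Omega> V L \<and> (\<forall>u\<in>V. \<forall>x\<in>\<Omega>. A u x = L u x + b x))"

definition skew_symmetric_operator ::
  "(real ^ 'd::finite) set \<Rightarrow> ('d, 'm::finite) field set \<Rightarrow> (('d, 'm) field \<Rightarrow> ('d, 'm) field) \<Rightarrow> bool"
where
  "skew_symmetric_operator \<Omega> Y D \<longleftrightarrow>
     (\<forall>v\<in>Y. \<forall>w\<in>Y.
        set_integrable lebesgue \<Omega> (\<lambda>x. D v x \<bullet> w x) \<and>
        (LINT x:\<Omega>|lebesgue. D v x \<bullet> w x) = - (LINT x:\<Omega>|lebesgue. v x \<bullet> D w x))"

subsection \<open>Functionals and their polarisations\<close>

definition hamiltonian ::
  "(real ^ 'd::finite) set \<Rightarrow> (('d, 'm::finite) jet \<Rightarrow> real) \<Rightarrow> ('d, 'm) field \<Rightarrow> real" where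
  "hamiltonian \<Omega> \<G> u = (LINT x:\<Omega>|lebesgue. \<G> (jet u x))"

definition hamiltonian_density ::
  "nat \<Rightarrow> (real ^ 'd::finite) set \<Rightarrow> ('d, 'm::finite) field set \<Rightarrow> (('d, 'm) jet \<Rightarrow> real) \<Rightarrow> bool"
where
  "hamiltonian_density r \<Omega> V \<G> \<longleftrightarrow>
     (\<forall>z z'. (\<forall>J. length J \<le> r \<longrightarrow> z J = z' J) \<longrightarrow> \<G> z = \<G> z') \<and>
     (\<forall>u\<in>V. set_integrable lebesgue \<Omega> (\<lambda>x. \<G> (jet u x)))"

definition multi_functional ::
  "(real ^ 'd::finite) set \<Rightarrow> (('d, 'm::finite) jet list \<Rightarrow> real) \<Rightarrow> ('d, 'm) field list \<Rightarrow> real" where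
  "multi_functional \<Omega> G ws = (LINT x:\<Omega>|lebesgue. G (map (\<lambda>w. jet w x) ws))"

definition polarised_hamiltonian ::
  "nat \<Rightarrow> (real ^ 'd::finite) set \<Rightarrow> ('d, 'm::finite) field set \<Rightarrow> nat \<Rightarrow>
   (('d, 'm) field \<Rightarrow> real) \<Rightarrow> (('d, 'm) jet list \<Rightarrow> real) \<Rightarrow> bool" where
  "polarised_hamiltonian r \<Omega> V k \<H> G \<longleftrightarrow>
     (\<forall>zs zs'. length zs = k \<longrightarrow> length zs' = k \<longrightarrow>
        (\<forall>i<k. \<forall>J. length J \<le> r \<longrightarrow> (zs ! i) J = (zs' ! i) J) \<longrightarrow> G zs = G zs') \<and>
     (\<forall>ws. length ws = k \<longrightarrow> set ws \<subseteq> V \<longrightarrow>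
        set_integrable lebesgue \<Omega> (\<lambda>x. G (map (\<lambda>w. jet w x) ws))) \<and>
     (\<forall>u\<in>V. multi_functional \<Omega> G (replicate k u) = \<H> u) \<and>
     (\<forall>ws. length ws = k \<longrightarrow> set ws \<subseteq> V \<longrightarrow>
        multi_functional \<Omega> G ws = multi_functional \<Omega> G (rotate1 ws))"

text \<open>The pair \<open>(J, \<alpha>)\<close> stands for the indeterminate \<open>w\<^sub>J\<^sup>\<alpha>\<close>.\<close>

definition jet_poly_deg2 ::
  "nat \<Rightarrow> (('d::finite, 'm::finite) jet \<Rightarrow> real) \<Rightarrow> bool" where
  "jet_poly_deg2 r g \<longleftrightarrow>
     (let P = {J :: 'd list. length J \<le> r} \<times> (UNIV :: 'm set) in
      \<exists>(c :: real) b a. \<forall>z.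
        g z = c + (\<Sum>(J, \<alpha>)\<in>P. b (J, \<alpha>) * z J $ \<alpha>)
                + (\<Sum>(J, \<alpha>)\<in>P. \<Sum>(K, \<beta>)\<in>P. a (J, \<alpha>) (K, \<beta>) * (z J $ \<alpha>) * (z K $ \<beta>)))"

definition quadratic_in_each_argument ::
  "nat \<Rightarrow> nat \<Rightarrow> (('d::finite, 'm::finite) jet list \<Rightarrow> real) \<Rightarrow> bool" where
  "quadratic_in_each_argument r k G \<longleftrightarrow>
     (\<forall>zs i. length zs = k \<longrightarrow> i < k \<longrightarrow> jet_poly_deg2 r (\<lambda>z. G (zs[i := z])))"

subsection \<open>Variational derivatives\<close>

definition has_variational_derivative ::
  "(real ^ 'd::finite) set \<Rightarrow> ('d, 'm::finite) field set \<Rightarrow> ('d, 'm) field set \<Rightarrow>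
   (('d, 'm) field \<Rightarrow> real) \<Rightarrow> ('d, 'm) field \<Rightarrow> ('d, 'm) field \<Rightarrow> bool" where
  "has_variational_derivative \<Omega> V Y F u v \<longleftrightarrow>
     v \<in> Y \<and>
     (\<forall>\<phi>\<in>V. set_integrable lebesgue \<Omega> (\<lambda>x. v x \<bullet> \<phi> x) \<and>
        ((\<lambda>\<epsilon>. F (\<lambda>x. u x + \<epsilon> *\<^sub>R \<phi> x)) has_real_derivative
           (LINT x:\<Omega>|lebesgue. v x \<bullet> \<phi> x)) (at 0))"

text \<open>
  The variational derivative, if it exists, is unique by the fundamental lemma of the calculus of
  variations: \<open>V\<close> contains all test functions, and elements of \<open>Y\<close> are continuous on \<open>\<Omega>\<close> and
  vanish outside.
\<close>

definition variational_derivative ::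
  "(real ^ 'd::finite) set \<Rightarrow> ('d, 'm::finite) field set \<Rightarrow> ('d, 'm) field set \<Rightarrow>
   (('d, 'm) field \<Rightarrow> real) \<Rightarrow> ('d, 'm) field \<Rightarrow> ('d, 'm) field" where
  "variational_derivative \<Omega> V Y F u = (THE v. has_variational_derivative \<Omega> V Y F u v)"

definition variational_derivative_fst ::
  "(real ^ 'd::finite) set \<Rightarrow> ('d, 'm::finite) field set \<Rightarrow> ('d, 'm) field set \<Rightarrow>
   (('d, 'm) field list \<Rightarrow> real) \<Rightarrow> ('d, 'm) field list \<Rightarrow> ('d, 'm) field" where
  "variational_derivative_fst \<Omega> V Y H ws =
     variational_derivative \<Omega> V Y (\<lambda>w. H (w # tl ws)) (hd ws)"

text \<open>
  This is the part of the standing assumptions (sufficient regularity, vanishing boundary terms)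
  that concerns the functional \<open>H\<close>: \<open>\<delta>H/\<delta>w\<^sub>1\<close> exists. Existence is not automatic, since it depends
  on the boundary terms of the integration by parts.
\<close>

definition variationally_differentiable_fst ::
  "(real ^ 'd::finite) set \<Rightarrow> ('d, 'm::finite) field set \<Rightarrow> ('d, 'm) field set \<Rightarrow> nat \<Rightarrow>
   (('d, 'm) field list \<Rightarrow> real) \<Rightarrow> bool" where
  "variationally_differentiable_fst \<Omega> V Y k H \<longleftrightarrow>
     (\<forall>ws. length ws = k \<longrightarrow> set ws \<subseteq> V \<longrightarrow>
        (\<exists>v. has_variational_derivative \<Omega> V Y (\<lambda>w. H (w # tl ws)) (hd ws) v))"

text \<open>The argument list is \<open>[w\<^sub>1, \<dots>, w\<^sub>k\<^sub>+\<^sub>1]\<close>, so \<open>tl (butlast ws)\<close> is \<open>[w\<^sub>2, \<dots>, w\<^sub>k]\<close>.\<close>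

definition avf_derivative ::
  "(real ^ 'd::finite) set \<Rightarrow> ('d, 'm::finite) field set \<Rightarrow> ('d, 'm) field set \<Rightarrow>
   (('d, 'm) field list \<Rightarrow> real) \<Rightarrow> ('d, 'm) field list \<Rightarrow> ('d, 'm) field" where
  "avf_derivative \<Omega> V Y H ws = (\<lambda>x. integral {0..1} (\<lambda>\<xi>.
     variational_derivative_fst \<Omega> V Y H
       ((\<lambda>y. \<xi> *\<^sub>R last ws y + (1 - \<xi>) *\<^sub>R hd ws y) # tl (butlast ws)) x))"

subsection \<open>Multistep schemes\<close>

text \<open>
  An operator \<open>D\<close> of the scheme depends on the list \<open>[U\<^sup>n\<^sup>+\<^sup>1, \<dots>, U\<^sup>n\<^sup>+\<^sup>k\<^sup>-\<^sup>1]\<close> only.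
\<close>

definition approximates_operator ::
  "(real ^ 'd::finite) set \<Rightarrow> ('d, 'm::finite) field set \<Rightarrow> ('d, 'm) field set \<Rightarrow> nat \<Rightarrow>
   (('d, 'm) field list \<Rightarrow> ('d, 'm) field \<Rightarrow> ('d, 'm) field) \<Rightarrow>
   (('d, 'm) field \<Rightarrow> ('d, 'm) field \<Rightarrow> ('d, 'm) field) \<Rightarrow> bool" where
  "approximates_operator \<Omega> V Y k D \<D> \<longleftrightarrow>
     (\<forall>us. length us = k - 1 \<longrightarrow> set us \<subseteq> V \<longrightarrow>
        linear_operator \<Omega> Y (D us) \<and> skew_symmetric_operator \<Omega> Y (D us)) \<and>
     (\<forall>u\<in>V. \<forall>v\<in>Y. \<forall>x\<in>\<Omega>. D (replicate (k - 1) u) v x = \<D> u v x)"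

text \<open>
  One step of a \<open>k\<close>-step scheme is the equation \<open>lhs us U = rhs us U\<close> on \<open>\<Omega>\<close> for the new value
  \<open>U = U\<^sup>n\<^sup>+\<^sup>k\<close>, where \<open>us = [U\<^sup>n, \<dots>, U\<^sup>n\<^sup>+\<^sup>k\<^sup>-\<^sup>1]\<close> is given. As the form of the equation does not depend on
  \<open>n\<close>, quantifying over all \<open>us\<close> covers all time steps.
\<close>

definition linearly_implicit ::
  "(real ^ 'd::finite) set \<Rightarrow> ('d, 'm::finite) field set \<Rightarrow> nat \<Rightarrow>
   (('d, 'm) field list \<Rightarrow> ('d, 'm) field \<Rightarrow> ('d, 'm) field) \<Rightarrow>
   (('d, 'm) field list \<Rightarrow> ('d, 'm) field \<Rightarrow> ('d, 'm) field) \<Rightarrow> bool" where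
  "linearly_implicit \<Omega> V k lhs rhs \<longleftrightarrow>
     (\<forall>us. length us = k \<longrightarrow> set us \<subseteq> V \<longrightarrow>
        affine_operator \<Omega> V (\<lambda>U x. lhs us U x - rhs us U x))"

end

theory Submission
  imports Defs
begin

text \<open>
  With the other arguments fixed, \<open>F[w] = H[w, w\<^sub>2, \<dots>, w\<^sub>k]\<close> is the integral of a density that is
  quadratic in the jet of \<open>w\<close>, so \<open>F\<close> is itself a quadratic function on the vector space \<open>V\<close>. Hence
  its derivative at \<open>u\<close> in direction \<open>\<phi>\<close> is \<open>(F[u + \<phi>] - F[u - \<phi>]) / 2\<close>, which is affine in \<open>u\<close>. As
  the variational derivative is unique, \<open>u \<mapsto> \<delta>F/\<delta>u\<close> preserves affine combinations. Therefore the
  average over \<open>\<xi>\<close> is \<open>(\<delta>F/\<delta>u [U\<^sup>n] + \<delta>F/\<delta>u [U\<^sup>n\<^sup>+\<^sup>k]) / 2\<close>, which is affine in \<open>U\<^sup>n\<^sup>+\<^sup>k\<close>, and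
  \<open>D\<close> is linear and independent of \<open>U\<^sup>n\<^sup>+\<^sup>k\<close>.
\<close>

subsection \<open>Bump functions\<close>

text \<open>The standard smooth function \<open>exp (- 1 / t)\<close> cut off at 0. The extra powers
  of \<open>inverse t\<close> make the family closed under differentiation up to linear
  combinations.\<close>

definition flat :: "nat \<Rightarrow> real \<Rightarrow> real" where
  "flat n t = (if t > 0 then inverse t ^ n * exp (- inverse t) else 0)"

lemma flat_nonneg: "flat n t \<ge> 0"
  by (simp add: flat_def)

lemma flat_pos: "t > 0 \<Longrightarrow> flat n t > 0"
  by (simp add: flat_def)

text \<open>From the right, substituting \<open>s = inverse t\<close> turns the claim into
  \<open>s ^ n / exp s\<close> tending to 0 at infinity; from the left the function is constantly
  0.\<close>

lemma flat_tendsto_0: "(flat n \<longlongrightarrow> 0) (at 0)"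
proof -
  have "((\<lambda>t. inverse t ^ n / exp (inverse t)) \<longlongrightarrow> (0::real)) (at_right 0)"
    by (rule filterlim_compose[OF tendsto_power_div_exp_0 filterlim_inverse_at_top_right])
  then have "(flat n \<longlongrightarrow> 0) (at_right 0)"
    by (rule Lim_transform_eventually)
      (auto simp: flat_def eventually_at_right_less exp_minus divide_inverse
        intro!: eventually_mono[OF eventually_at_right_less])
  moreover have "(flat n \<longlongrightarrow> 0) (at_left 0)"
    by (rule Lim_transform_eventually[OF tendsto_const])
      (auto simp: flat_def eventually_at_filter)
  ultimately show ?thesis
    by (simp add: filterlim_at_split)
qed

lemma flat_has_derivative:
  "(flat n has_real_derivative (flat (n + 2) t - real n * flat (n + 1) t)) (at t)"
proof -
  consider "t < 0" | "t = 0" | "t > 0" by linarith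
  then show ?thesis
  proof cases
    case 1
    have "((\<lambda>_. 0) has_real_derivative 0) (at t)" by simp
    then have "(flat n has_real_derivative 0) (at t)"
      by (rule has_field_derivative_transform_within_open[where S="{..<0}"])
        (use 1 in \<open>auto simp: flat_def\<close>)
    with 1 show ?thesis by (simp add: flat_def)
  next
    case 2
    \<comment> \<open>The difference quotient of \<open>flat n\<close> at 0 is
      \<open>flat (Suc n)\<close> itself, so the previous limit gives the derivative.\<close>
    have "((\<lambda>h. (flat n (0 + h) - flat n 0) / h) \<longlongrightarrow> 0) (at 0)"
      by (rule Lim_transform_eventually[OF flat_tendsto_0[of "Suc n"]])
        (auto simp: flat_def divide_inverse)
    then have "(flat n has_real_derivative 0) (at 0)"
      by (simp add: DERIV_def)
    with 2 show ?thesis by (simp add: flat_def)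
  next
    case 3
    let ?i = "inverse t"
    have "((\<lambda>s. inverse s ^ n * exp (- inverse s)) has_real_derivative
        real n * ?i ^ (n - 1) * (- (?i * ?i)) * exp (- ?i) + exp (- ?i) * (?i * ?i) * ?i ^ n) (at t)"
      using 3 by (auto intro!: derivative_eq_intros)
    also have "real n * ?i ^ (n - 1) * (- (?i * ?i)) * exp (- ?i) + exp (- ?i) * (?i * ?i) * ?i ^ n
        = flat (n + 2) t - real n * flat (n + 1) t"
      \<comment> \<open>The case split deals with the truncated exponent \<open>n - 1\<close>; for
        \<open>n = 0\<close> that summand vanishes.\<close>
      using 3 by (cases n) (simp_all add: flat_def algebra_simps)
    finally have "((\<lambda>s. inverse s ^ n * exp (- inverse s)) has_real_derivative
        (flat (n + 2) t - real n * flat (n + 1) t)) (at t)" .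
    then show ?thesis
      by (rule has_field_derivative_transform_within_open[where S="{0<..}"])
        (use 3 in \<open>auto simp: flat_def\<close>)
  qed
qed

section \<open>An algebra of smooth functions closed under partial derivatives\<close>

text \<open>Closure under partial derivatives replaces explicit formulas for higher derivatives of a
  bump: smoothness follows by induction on the multi-index, each derivative staying in the
  algebra.\<close>

inductive_set bump_algebra :: "real ^ 'd::finite \<Rightarrow> real \<Rightarrow> (real ^ 'd \<Rightarrow> real) set"
  for c :: "real ^ 'd" and \<rho> :: real where
  const: "(\<lambda>x. a) \<in> bump_algebra c \<rho>"
| coord: "(\<lambda>x. x $ i) \<in> bump_algebra c \<rho>"
| flat: "(\<lambda>x. flat n (\<rho> - (x - c) \<bullet> (x - c))) \<in> bump_algebra c \<rho>"
| add: "f \<in> bump_algebra c \<rho> \<Longrightarrow> g \<in> bump_algebra c \<rho> \<Longrightarrow> (\<lambda>x. f x + g x) \<in> bump_algebra c \<rho>"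
| mult: "f \<in> bump_algebra c \<rho> \<Longrightarrow> g \<in> bump_algebra c \<rho> \<Longrightarrow> (\<lambda>x. f x * g x) \<in> bump_algebra c \<rho>"

text \<open>Sum and product rules handle the closure steps. For the generator \<open>flat n\<close>,
  the chain rule multiplies an expression in \<open>flat (n + 2)\<close> and
  \<open>flat (n + 1)\<close> by a polynomial of degree one.\<close>

lemma bump_algebra_derivative:
  assumes "f \<in> bump_algebra c \<rho>"
  obtains f' where "\<And>x. (f has_derivative f' x) (at x)"
    and "\<And>i. (\<lambda>x. f' x (axis i 1)) \<in> bump_algebra c \<rho>"
  using assms
proof (induction arbitrary: thesis)
  case (const a)
  show ?case
    by (rule const[of "\<lambda>_ _. 0"]) (auto intro: bump_algebra.intros)
next
  case (coord j)
  show ?case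
    by (rule coord[of "\<lambda>_ h. h $ j"])
      (auto intro: bump_algebra.intros bounded_linear_imp_has_derivative bounded_linear_vec_nth)
next
  case (flat n)
  let ?p = "\<lambda>x. \<rho> - (x - c) \<bullet> (x - c)"
  let ?f' = "\<lambda>x h. (flat (n + 2) (?p x) - real n * flat (n + 1) (?p x)) * (- 2 * ((x - c) \<bullet> h))"
  show ?case
  proof (rule flat[of ?f'])
    fix x
    have "(?p has_derivative (\<lambda>h. - 2 * ((x - c) \<bullet> h))) (at x)"
      by (auto intro!: derivative_eq_intros simp: inner_commute)
    from has_derivative_compose[OF this flat_has_derivative[of n "?p x", unfolded has_field_derivative_def]]
    show "((\<lambda>x. flat n (?p x)) has_derivative ?f' x) (at x)" .
  next
    fix i
    \<comment> \<open>Differences are spelled as sums with negative constants, since the algebra is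
      generated by sums and products only.\<close>
    have "(\<lambda>x. (flat (n + 2) (?p x) + (- real n) * flat (n + 1) (?p x)) * (- 2 * (x $ i + - c $ i)))
        \<in> bump_algebra c \<rho>"
      by (intro bump_algebra.intros)
    then show "(\<lambda>x. ?f' x (axis i 1)) \<in> bump_algebra c \<rho>"
      by (simp add: inner_axis)
  qed
next
  case (add f g)
  obtain f' where f': "\<And>x. (f has_derivative f' x) (at x)"
    "\<And>i. (\<lambda>x. f' x (axis i 1)) \<in> bump_algebra c \<rho>" using add.IH(1) by blast
  obtain g' where g': "\<And>x. (g has_derivative g' x) (at x)"
    "\<And>i. (\<lambda>x. g' x (axis i 1)) \<in> bump_algebra c \<rho>" using add.IH(2) by blast
  show ?case
    by (rule add.prems[of "\<lambda>x h. f' x h + g' x h"])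
      (auto intro: has_derivative_add f' g' bump_algebra.intros)
next
  case (mult f g)
  obtain f' where f': "\<And>x. (f has_derivative f' x) (at x)"
    "\<And>i. (\<lambda>x. f' x (axis i 1)) \<in> bump_algebra c \<rho>" using mult.IH(1) by blast
  obtain g' where g': "\<And>x. (g has_derivative g' x) (at x)"
    "\<And>i. (\<lambda>x. g' x (axis i 1)) \<in> bump_algebra c \<rho>" using mult.IH(2) by blast
  show ?case
    by (rule mult.prems[of "\<lambda>x h. f x * g' x h + f' x h * g x"])
      (rule has_derivative_mult[OF f'(1) g'(1)], intro bump_algebra.add bump_algebra.mult mult.hyps f' g')
qed

lemma partial_bump_algebra:
  assumes "f \<in> bump_algebra c \<rho>"
  obtains g where "g \<in> bump_algebra c \<rho>"
    and "partial i (\<lambda>x. f x *\<^sub>R e) = (\<lambda>x. g x *\<^sub>R (e :: real ^ 'm::finite))"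
proof -
  obtain f' where f': "\<And>x. (f has_derivative f' x) (at x)"
    "\<And>i. (\<lambda>x. f' x (axis i 1)) \<in> bump_algebra c \<rho>"
    using bump_algebra_derivative[OF assms] by blast
  have "frechet_derivative (\<lambda>x. f x *\<^sub>R e) (at x) = (\<lambda>h. f' x h *\<^sub>R e)" for x
    by (rule frechet_derivative_at[symmetric]) (rule has_derivative_scaleR_left[OF f'(1)])
  then show thesis
    by (intro that[OF f'(2)[of i]]) (simp add: partial_def)
qed

lemma partials_bump_algebra:
  assumes "f \<in> bump_algebra c \<rho>"
  obtains g where "g \<in> bump_algebra c \<rho>"
    and "partials J (\<lambda>x. f x *\<^sub>R e) = (\<lambda>x. g x *\<^sub>R (e :: real ^ 'm::finite))"
proof (induction J arbitrary: thesis)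
  case Nil
  show ?case by (rule Nil[OF assms]) simp
next
  case (Cons i J)
  obtain g where g: "g \<in> bump_algebra c \<rho>" "partials J (\<lambda>x. f x *\<^sub>R e) = (\<lambda>x. g x *\<^sub>R e)"
    using Cons.IH by blast
  obtain h where "h \<in> bump_algebra c \<rho>" "partial i (\<lambda>x. g x *\<^sub>R e) = (\<lambda>x. h x *\<^sub>R e)"
    using partial_bump_algebra[OF g(1)] by blast
  with g(2) show ?case by (intro Cons.prems) auto
qed

lemma Ck_on_bump_algebra:
  assumes "f \<in> bump_algebra c \<rho>"
  shows "Ck_on r \<Omega> (\<lambda>x. f x *\<^sub>R (e :: real ^ 'm::finite))"
proof -
  have "partials J (\<lambda>x. f x *\<^sub>R e) differentiable_on \<Omega>" for J
  proof -
    obtain g where g: "g \<in> bump_algebra c \<rho>" "partials J (\<lambda>x. f x *\<^sub>R e) = (\<lambda>x. g x *\<^sub>R e)"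
      using partials_bump_algebra[OF assms] by blast
    obtain g' where "\<And>x. (g has_derivative g' x) (at x)"
      "\<And>i. (\<lambda>x. g' x (axis i 1)) \<in> bump_algebra c \<rho>"
      using bump_algebra_derivative[OF g(1)] by blast
    from this(1) have "((\<lambda>x. g x *\<^sub>R e) has_derivative (\<lambda>h. g' x h *\<^sub>R e)) (at x)" for x
      by (rule has_derivative_scaleR_left)
    then show ?thesis
      unfolding g(2) differentiable_on_def differentiable_def
      by (blast intro: has_derivative_at_withinI)
  qed
  then show ?thesis
    by (simp add: Ck_on_def differentiable_imp_continuous_on)
qed

lemma bump_outside:
  assumes "\<delta> > 0" and "x \<notin> cball c \<delta>"
  shows "flat n (\<delta>\<^sup>2 - (x - c) \<bullet> (x - c)) = 0"
proof -
  have "\<delta> \<le> norm (x - c)"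
    using assms(2) by (simp add: dist_norm norm_minus_commute)
  then have "\<delta>\<^sup>2 \<le> (x - c) \<bullet> (x - c)"
    using assms(1) power_mono[of \<delta> "norm (x - c)" 2] by (simp add: power2_norm_eq_inner)
  then show ?thesis by (simp add: flat_def)
qed

lemma bump_test_function:
  assumes "\<delta> > 0" and "cball c \<delta> \<subseteq> \<Omega>"
  shows "(\<lambda>x. flat 0 (\<delta>\<^sup>2 - (x - c) \<bullet> (x - c)) *\<^sub>R e) \<in> test_functions \<Omega>"
proof -
  have "\<forall>x. x \<notin> cball c \<delta> \<longrightarrow> flat 0 (\<delta>\<^sup>2 - (x - c) \<bullet> (x - c)) *\<^sub>R e = 0"
  proof (intro allI impI)
    fix x assume "x \<notin> cball c \<delta>"
    with assms(1) have "flat 0 (\<delta>\<^sup>2 - (x - c) \<bullet> (x - c)) = 0" by (rule bump_outside)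
    then show "flat 0 (\<delta>\<^sup>2 - (x - c) \<bullet> (x - c)) *\<^sub>R e = 0" by simp
  qed
  with assms(2) show ?thesis
    unfolding test_functions_def
    by (intro CollectI conjI allI Ck_on_bump_algebra[OF bump_algebra.flat] exI[of _ "cball c \<delta>"]
        compact_cball) auto
qed

subsection \<open>Uniqueness of the variational derivative\<close>

text \<open>If \<open>v c\<close> were nonzero, \<open>v\<close> would have positive component along
  \<open>v c\<close> on a closed ball inside \<Omega>. Testing with a bump on that ball times the
  fixed vector \<open>v c\<close> gives a nonnegative integrand with integral 0, so the open ball
  would be null, which is impossible.\<close>

lemma fundamental_lemma:
  fixes v :: "('d::finite, 'm::finite) field"
  assumes "open \<Omega>" and "continuous_on \<Omega> v"
    and int: "\<And>\<phi>. \<phi> \<in> test_functions \<Omega> \<Longrightarrow> set_integrable lebesgue \<Omega> (\<lambda>x. v x \<bullet> \<phi> x)"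
    and zero: "\<And>\<phi>. \<phi> \<in> test_functions \<Omega> \<Longrightarrow> (LINT x:\<Omega>|lebesgue. v x \<bullet> \<phi> x) = 0"
    and "c \<in> \<Omega>"
  shows "v c = 0"
proof (rule ccontr)
  assume "v c \<noteq> 0"
  have "continuous_on \<Omega> (\<lambda>x. v x \<bullet> v c)"
    using assms(2) by (intro continuous_intros)
  then have "open (\<Omega> \<inter> (\<lambda>x. v x \<bullet> v c) -` {0<..})"
    by (rule continuous_open_preimage[OF _ assms(1)]) simp
  moreover have "c \<in> \<Omega> \<inter> (\<lambda>x. v x \<bullet> v c) -` {0<..}"
    using \<open>v c \<noteq> 0\<close> \<open>c \<in> \<Omega>\<close> by simp
  ultimately obtain \<delta> where \<delta>: "\<delta> > 0" "cball c \<delta> \<subseteq> \<Omega> \<inter> (\<lambda>x. v x \<bullet> v c) -` {0<..}"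
    unfolding open_contains_cball by blast
  define f where "f x = flat 0 (\<delta>\<^sup>2 - (x - c) \<bullet> (x - c))" for x
  let ?\<phi> = "\<lambda>x. f x *\<^sub>R v c"
  let ?g = "\<lambda>x. indicator \<Omega> x *\<^sub>R (v x \<bullet> ?\<phi> x)"
  have \<phi>: "?\<phi> \<in> test_functions \<Omega>"
    unfolding f_def using \<delta> by (intro bump_test_function) auto
  have out: "f x = 0" if "x \<notin> cball c \<delta>" for x
    unfolding f_def using \<delta>(1) that by (rule bump_outside)
  have inside: "f x > 0" if "x \<in> ball c \<delta>" for x
  proof -
    have "norm (x - c) < \<delta>"
      using that by (simp add: dist_norm norm_minus_commute)
    then have "(x - c) \<bullet> (x - c) < \<delta>\<^sup>2"
      using power_strict_mono[of "norm (x - c)" \<delta> 2] by (simp add: power2_norm_eq_inner)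
    then show ?thesis by (simp add: f_def flat_pos)
  qed
  have "?g x \<ge> 0" for x
  proof (cases "x \<in> cball c \<delta>")
    case True
    with \<delta>(2) have "v x \<bullet> v c > 0" by blast
    then show ?thesis by (simp add: f_def flat_nonneg)
  qed (simp add: out)
  moreover have "integrable lebesgue ?g"
    using int[OF \<phi>] by (simp add: set_integrable_def)
  moreover have "integral\<^sup>L lebesgue ?g = 0"
    using zero[OF \<phi>] by (simp add: set_lebesgue_integral_def)
  ultimately have "AE x in lebesgue. ?g x = 0"
    by (subst integral_nonneg_eq_0_iff_AE[symmetric]) auto
  then have "AE x in lebesgue. x \<notin> ball c \<delta>"
  proof eventually_elim
    case (elim x)
    show ?case
    proof
      assume x: "x \<in> ball c \<delta>"
      then have "x \<in> cball c \<delta>" by simp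
      with \<delta>(2) have "x \<in> \<Omega>" "v x \<bullet> v c > 0" by blast+
      with elim inside[OF x] show False by simp
    qed
  qed
  then have "negligible (ball c \<delta>)"
    using AE_iff_null_sets[of "ball c \<delta>" lebesgue] by (simp add: negligible_iff_null_sets)
  with \<delta>(1) show False
    using open_not_negligible[of "ball c \<delta>"] by simp
qed

lemma field_subspace_affine:
  assumes "field_subspace V" "u \<in> V" "v \<in> V"
  shows "(\<lambda>x. a *\<^sub>R u x + b *\<^sub>R v x) \<in> V"
proof -
  have "(\<lambda>x. a *\<^sub>R u x) \<in> V" "(\<lambda>x. b *\<^sub>R v x) \<in> V"
    using assms by (auto simp: field_subspace_def)
  moreover have "(\<lambda>x. f x + g x) \<in> V" if "f \<in> V" "g \<in> V" for f g
    using assms(1) that by (simp add: field_subspace_def)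
  ultimately show ?thesis by blast
qed

lemma field_subspace_add_scaled:
  assumes "field_subspace V" "u \<in> V" "v \<in> V"
  shows "(\<lambda>x. u x + b *\<^sub>R v x) \<in> V"
  using field_subspace_affine[OF assms, of 1 b] by simp

text \<open>Real derivatives are unique, so \<open>v - w\<close> integrates to 0 against every test
  function and the fundamental lemma applies on \<Omega>. Off \<Omega> both functions vanish by the
  zero-extension convention.\<close>

lemma variational_derivative_unique:
  fixes v w :: "('d::finite, 'm::finite) field"
  assumes "open \<Omega>" and "admissible_states r \<Omega> V" and "covector_space \<Omega> Y"
    and v: "has_variational_derivative \<Omega> V Y F u v"
    and w: "has_variational_derivative \<Omega> V Y F u w"
  shows "v = w"
proof
  fix x
  have vw: "v \<in> Y" "w \<in> Y"
    using v w by (auto simp: has_variational_derivative_def)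
  show "v x = w x"
  proof (cases "x \<in> \<Omega>")
    case True
    have "v x - w x = 0"
    proof (rule fundamental_lemma[OF assms(1) _ _ _ True])
      show "continuous_on \<Omega> (\<lambda>x. v x - w x)"
        using vw assms(3) by (auto simp: covector_space_def intro: continuous_on_diff)
    next
      fix \<phi> :: "('d, 'm) field" assume "\<phi> \<in> test_functions \<Omega>"
      then have "\<phi> \<in> V" using assms(2) by (auto simp: admissible_states_def)
      then have i: "set_integrable lebesgue \<Omega> (\<lambda>x. v x \<bullet> \<phi> x)" "set_integrable lebesgue \<Omega> (\<lambda>x. w x \<bullet> \<phi> x)"
        and e: "(LINT x:\<Omega>|lebesgue. v x \<bullet> \<phi> x) = (LINT x:\<Omega>|lebesgue. w x \<bullet> \<phi> x)"
        using v w by (auto simp: has_variational_derivative_def intro: DERIV_unique)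
      show "set_integrable lebesgue \<Omega> (\<lambda>x. (v x - w x) \<bullet> \<phi> x)"
        using set_integral_diff(1)[OF i] by (simp add: inner_diff_left)
      show "(LINT x:\<Omega>|lebesgue. (v x - w x) \<bullet> \<phi> x) = 0"
        using set_integral_diff(2)[OF i] e by (simp add: inner_diff_left)
    qed
    then show ?thesis by simp
  next
    case False
    with vw assms(3) have "v x = 0" "w x = 0" by (auto simp: covector_space_def)
    then show ?thesis by simp
  qed
qed

lemma variational_derivative_eq:
  assumes "open \<Omega>" and "admissible_states r \<Omega> V" and "covector_space \<Omega> Y"
    and "has_variational_derivative \<Omega> V Y F u v"
  shows "variational_derivative \<Omega> V Y F u = v"
  unfolding variational_derivative_def
  using assms(4) variational_derivative_unique[OF assms(1-3)] by blast

subsection \<open>Quadratic functionals\<close>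

text \<open>
  The first clause is quadratic interpolation at \<open>-1, 0, 1\<close> along lines, the second says that central
  differences are affine in the base point. Both are linear identities between values of the
  functional, so integration preserves them without any measurability of the coefficients.
\<close>

definition quadratic_functional :: "('d::finite, 'm::finite) field set \<Rightarrow> (('d, 'm) field \<Rightarrow> real) \<Rightarrow> bool"
where
  "quadratic_functional V F \<longleftrightarrow>
     (\<forall>u\<in>V. \<forall>\<phi>\<in>V. \<forall>\<epsilon>. F (\<lambda>x. u x + \<epsilon> *\<^sub>R \<phi> x) =
        (1 - \<epsilon>\<^sup>2) * F u + ((\<epsilon>\<^sup>2 + \<epsilon>) / 2) * F (\<lambda>x. u x + 1 *\<^sub>R \<phi> x)
        + ((\<epsilon>\<^sup>2 - \<epsilon>) / 2) * F (\<lambda>x. u x + (- 1) *\<^sub>R \<phi> x)) \<and>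
     (\<forall>u\<in>V. \<forall>w\<in>V. \<forall>\<phi>\<in>V. \<forall>t.
        F (\<lambda>x. ((1 - t) *\<^sub>R u x + t *\<^sub>R w x) + 1 *\<^sub>R \<phi> x) - F (\<lambda>x. ((1 - t) *\<^sub>R u x + t *\<^sub>R w x) + (- 1) *\<^sub>R \<phi> x) =
        (1 - t) * (F (\<lambda>x. u x + 1 *\<^sub>R \<phi> x) - F (\<lambda>x. u x + (- 1) *\<^sub>R \<phi> x))
        + t * (F (\<lambda>x. w x + 1 *\<^sub>R \<phi> x) - F (\<lambda>x. w x + (- 1) *\<^sub>R \<phi> x)))"

text \<open>In the interpolation formula only the three weights depend on \<epsilon>; their
  derivatives at 0 are 0, 1/2 and -1/2.\<close>

lemma quadratic_functional_has_derivative: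
  assumes "quadratic_functional V F" and "u \<in> V" and "\<phi> \<in> V"
  shows "((\<lambda>\<epsilon>. F (\<lambda>x. u x + \<epsilon> *\<^sub>R \<phi> x)) has_real_derivative
     (F (\<lambda>x. u x + 1 *\<^sub>R \<phi> x) - F (\<lambda>x. u x + (- 1) *\<^sub>R \<phi> x)) / 2) (at 0)"
proof -
  have "((\<lambda>\<epsilon>. (1 - \<epsilon>\<^sup>2) * a + ((\<epsilon>\<^sup>2 + \<epsilon>) / 2) * b + ((\<epsilon>\<^sup>2 - \<epsilon>) / 2) * c) has_real_derivative (b - c) / 2) (at 0)"
    for a b c :: real
    by (auto intro!: derivative_eq_intros simp: field_simps)
  moreover have "(\<lambda>\<epsilon>. F (\<lambda>x. u x + \<epsilon> *\<^sub>R \<phi> x)) =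
      (\<lambda>\<epsilon>. (1 - \<epsilon>\<^sup>2) * F u + ((\<epsilon>\<^sup>2 + \<epsilon>) / 2) * F (\<lambda>x. u x + 1 *\<^sub>R \<phi> x)
        + ((\<epsilon>\<^sup>2 - \<epsilon>) / 2) * F (\<lambda>x. u x + (- 1) *\<^sub>R \<phi> x))"
    using assms unfolding quadratic_functional_def by blast
  ultimately show ?thesis by (simp only:)
qed

text \<open>Pairing a variational derivative with \<phi> gives half the central difference of
  \<open>F\<close> in direction \<phi>, which is affine in the base point. The weight
  \<open>t\<close> may be any real, not just one in the unit interval; homogeneity of the linear
  part later relies on this.\<close>

lemma has_variational_derivative_affine:
  assumes V: "field_subspace V" and Y: "field_subspace Y" and F: "quadratic_functional V F"
    and "u \<in> V" "w \<in> V"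
    and a: "has_variational_derivative \<Omega> V Y F u a"
    and b: "has_variational_derivative \<Omega> V Y F w b"
  shows "has_variational_derivative \<Omega> V Y F
    (\<lambda>x. (1 - t) *\<^sub>R u x + t *\<^sub>R w x) (\<lambda>x. (1 - t) *\<^sub>R a x + t *\<^sub>R b x)"
    (is "has_variational_derivative \<Omega> V Y F ?m ?c")
  unfolding has_variational_derivative_def
proof (intro conjI ballI)
  show "?c \<in> Y"
    using a b by (intro field_subspace_affine[OF Y]) (auto simp: has_variational_derivative_def)
next
  fix \<phi> assume \<phi>: "\<phi> \<in> V"
  have m: "?m \<in> V" using V \<open>u \<in> V\<close> \<open>w \<in> V\<close> by (intro field_subspace_affine)
  have i: "set_integrable lebesgue \<Omega> (\<lambda>x. (1 - t) * (a x \<bullet> \<phi> x))"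
      "set_integrable lebesgue \<Omega> (\<lambda>x. t * (b x \<bullet> \<phi> x))"
    using a b \<phi> by (auto simp: has_variational_derivative_def)
  have eq: "?c x \<bullet> \<phi> x = (1 - t) * (a x \<bullet> \<phi> x) + t * (b x \<bullet> \<phi> x)" for x
    by (simp add: inner_add_left)
  show "set_integrable lebesgue \<Omega> (\<lambda>x. ?c x \<bullet> \<phi> x)"
    unfolding eq by (rule set_integral_add(1)[OF i])
  let ?d = "\<lambda>u. F (\<lambda>x. u x + 1 *\<^sub>R \<phi> x) - F (\<lambda>x. u x + (- 1) *\<^sub>R \<phi> x)"
  have A: "(LINT x:\<Omega>|lebesgue. a x \<bullet> \<phi> x) = ?d u / 2"
    using a \<phi> quadratic_functional_has_derivative[OF F \<open>u \<in> V\<close> \<phi>]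
    unfolding has_variational_derivative_def by (blast intro: DERIV_unique)
  have B: "(LINT x:\<Omega>|lebesgue. b x \<bullet> \<phi> x) = ?d w / 2"
    using b \<phi> quadratic_functional_has_derivative[OF F \<open>w \<in> V\<close> \<phi>]
    unfolding has_variational_derivative_def by (blast intro: DERIV_unique)
  have M: "?d ?m = (1 - t) * ?d u + t * ?d w"
    using F \<open>u \<in> V\<close> \<open>w \<in> V\<close> \<phi> unfolding quadratic_functional_def by blast
  have C: "(LINT x:\<Omega>|lebesgue. ?c x \<bullet> \<phi> x) = ?d ?m / 2"
    unfolding eq set_integral_add(2)[OF i] set_integral_mult_right A B M by (simp add: field_simps)
  show "((\<lambda>\<epsilon>. F (\<lambda>x. ?m x + \<epsilon> *\<^sub>R \<phi> x)) has_real_derivative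
      (LINT x:\<Omega>|lebesgue. ?c x \<bullet> \<phi> x)) (at 0)"
    unfolding C by (rule quadratic_functional_has_derivative[OF F m \<phi>])
qed

text \<open>Both defining identities hold at each point of \<Omega>, and every field in them lies in
  \<open>V\<close>, so each term is integrable and the integral splits.\<close>

lemma quadratic_functional_integral:
  assumes "\<Omega> \<in> sets lebesgue" and V: "field_subspace V"
    and q: "\<And>x. x \<in> \<Omega> \<Longrightarrow> quadratic_functional V (\<lambda>w. f w x)"
    and i: "\<And>w. w \<in> V \<Longrightarrow> set_integrable lebesgue \<Omega> (f w)"
  shows "quadratic_functional V (\<lambda>w. LINT x:\<Omega>|lebesgue. f w x)"
proof -
  let ?I = "\<lambda>w. LINT x:\<Omega>|lebesgue. f w x"
  have V3: "(\<lambda>x. u x + \<epsilon> *\<^sub>R \<phi> x) \<in> V" if "u \<in> V" "\<phi> \<in> V" for u \<phi> \<epsilon>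
    using V that by (rule field_subspace_add_scaled)
  have lines: "?I (\<lambda>x. u x + \<epsilon> *\<^sub>R \<phi> x) =
        (1 - \<epsilon>\<^sup>2) * ?I u + ((\<epsilon>\<^sup>2 + \<epsilon>) / 2) * ?I (\<lambda>x. u x + 1 *\<^sub>R \<phi> x)
        + ((\<epsilon>\<^sup>2 - \<epsilon>) / 2) * ?I (\<lambda>x. u x + (- 1) *\<^sub>R \<phi> x)" if "u \<in> V" "\<phi> \<in> V" for u \<phi> \<epsilon>
  proof -
    have "?I (\<lambda>x. u x + \<epsilon> *\<^sub>R \<phi> x) = (LINT x:\<Omega>|lebesgue. (1 - \<epsilon>\<^sup>2) * f u x
        + ((\<epsilon>\<^sup>2 + \<epsilon>) / 2) * f (\<lambda>x. u x + 1 *\<^sub>R \<phi> x) x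
        + ((\<epsilon>\<^sup>2 - \<epsilon>) / 2) * f (\<lambda>x. u x + (- 1) *\<^sub>R \<phi> x) x)"
      using q that unfolding quadratic_functional_def
      by (intro set_lebesgue_integral_cong[OF assms(1)]) blast
    also have "\<dots> = (1 - \<epsilon>\<^sup>2) * ?I u + ((\<epsilon>\<^sup>2 + \<epsilon>) / 2) * ?I (\<lambda>x. u x + 1 *\<^sub>R \<phi> x)
        + ((\<epsilon>\<^sup>2 - \<epsilon>) / 2) * ?I (\<lambda>x. u x + (- 1) *\<^sub>R \<phi> x)"
      using i V3 that
      by (simp only: set_integral_add set_integral_mult_right set_integrable_mult_right)
    finally show ?thesis .
  qed
  have diffs: "?I (\<lambda>x. m x + 1 *\<^sub>R \<phi> x) - ?I (\<lambda>x. m x + (- 1) *\<^sub>R \<phi> x) =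
        (1 - t) * (?I (\<lambda>x. u x + 1 *\<^sub>R \<phi> x) - ?I (\<lambda>x. u x + (- 1) *\<^sub>R \<phi> x))
        + t * (?I (\<lambda>x. w x + 1 *\<^sub>R \<phi> x) - ?I (\<lambda>x. w x + (- 1) *\<^sub>R \<phi> x))"
    if "u \<in> V" "w \<in> V" "\<phi> \<in> V" and m: "m = (\<lambda>x. (1 - t) *\<^sub>R u x + t *\<^sub>R w x)" for u w m \<phi> t
  proof -
    have mV: "m \<in> V" using V that by (auto intro: field_subspace_affine)
    have "?I (\<lambda>x. m x + 1 *\<^sub>R \<phi> x) - ?I (\<lambda>x. m x + (- 1) *\<^sub>R \<phi> x) =
        (LINT x:\<Omega>|lebesgue. f (\<lambda>x. m x + 1 *\<^sub>R \<phi> x) x - f (\<lambda>x. m x + (- 1) *\<^sub>R \<phi> x) x)"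
      using i V3 mV that by (simp only: set_integral_diff)
    also have "\<dots> = (LINT x:\<Omega>|lebesgue.
        (1 - t) * (f (\<lambda>x. u x + 1 *\<^sub>R \<phi> x) x - f (\<lambda>x. u x + (- 1) *\<^sub>R \<phi> x) x)
        + t * (f (\<lambda>x. w x + 1 *\<^sub>R \<phi> x) x - f (\<lambda>x. w x + (- 1) *\<^sub>R \<phi> x) x))"
      using q that unfolding quadratic_functional_def
      by (intro set_lebesgue_integral_cong[OF assms(1)]) blast
    also have "\<dots> = (1 - t) * (?I (\<lambda>x. u x + 1 *\<^sub>R \<phi> x) - ?I (\<lambda>x. u x + (- 1) *\<^sub>R \<phi> x))
        + t * (?I (\<lambda>x. w x + 1 *\<^sub>R \<phi> x) - ?I (\<lambda>x. w x + (- 1) *\<^sub>R \<phi> x))"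
      using i V3 that
      by (simp only: set_integral_add set_integral_diff set_integral_mult_right set_integrable_mult_right)
    finally show ?thesis .
  qed
  from lines diffs show ?thesis
    unfolding quadratic_functional_def by blast
qed

section \<open>Polynomial densities and jets\<close>

text \<open>Replaces coefficients by a linear form and the diagonal of a bilinear form, so that
  later algebra uses linearity alone. \<open>B\<close> need not be symmetric.\<close>

lemma jet_poly_deg2_bilinear:
  fixes g :: "('d::finite, 'm::finite) jet \<Rightarrow> real"
  assumes "jet_poly_deg2 r g"
  obtains c l B where "\<And>z. g z = c + l z + B z z"
    and "\<And>z z' s t. l (\<lambda>J. s *\<^sub>R z J + t *\<^sub>R z' J) = s * l z + t * l z'"
    and "\<And>z z' w s t. B (\<lambda>J. s *\<^sub>R z J + t *\<^sub>R z' J) w = s * B z w + t * B z' w"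
    and "\<And>z z' w s t. B w (\<lambda>J. s *\<^sub>R z J + t *\<^sub>R z' J) = s * B w z + t * B w z'"
proof -
  define P where "P = {J :: 'd list. length J \<le> r} \<times> (UNIV :: 'm set)"
  obtain c b a where g: "\<And>z. g z = c + (\<Sum>(J, \<alpha>)\<in>P. b (J, \<alpha>) * z J $ \<alpha>)
      + (\<Sum>(J, \<alpha>)\<in>P. \<Sum>(K, \<beta>)\<in>P. a (J, \<alpha>) (K, \<beta>) * (z J $ \<alpha>) * (z K $ \<beta>))"
    using assms unfolding jet_poly_deg2_def P_def Let_def by blast
  define l :: "('d, 'm) jet \<Rightarrow> real" where "l z = (\<Sum>(J, \<alpha>)\<in>P. b (J, \<alpha>) * z J $ \<alpha>)" for z
  define B :: "('d, 'm) jet \<Rightarrow> ('d, 'm) jet \<Rightarrow> real"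
    where "B z w = (\<Sum>(J, \<alpha>)\<in>P. \<Sum>(K, \<beta>)\<in>P. a (J, \<alpha>) (K, \<beta>) * (z J $ \<alpha>) * (w K $ \<beta>))" for z w
  show thesis
  proof (rule that[of c l B])
    show "g z = c + l z + B z z" for z by (simp add: g l_def B_def)
    show "l (\<lambda>J. s *\<^sub>R z J + t *\<^sub>R z' J) = s * l z + t * l z'" for z z' s t
      by (simp add: l_def sum_distrib_left flip: sum.distrib)
        (auto intro!: sum.cong simp: algebra_simps)
    show "B (\<lambda>J. s *\<^sub>R z J + t *\<^sub>R z' J) w = s * B z w + t * B z' w" for z z' w s t
      by (simp add: B_def sum_distrib_left split_def flip: sum.distrib)
        (auto intro!: sum.cong simp: algebra_simps)
    show "B w (\<lambda>J. s *\<^sub>R z J + t *\<^sub>R z' J) = s * B w z + t * B w z'" for z z' w s t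
      by (simp add: B_def sum_distrib_left split_def flip: sum.distrib)
        (auto intro!: sum.cong simp: algebra_simps)
  qed
qed

text \<open>The polynomial reads only derivatives up to order \<open>r\<close>, exactly those for
  which states are regular enough that jets depend linearly on the field.\<close>

lemma jet_poly_deg2_cong:
  assumes "jet_poly_deg2 r g" and "\<And>J. length J \<le> r \<Longrightarrow> z J = z' J"
  shows "g z = g z'"
proof -
  obtain c b a where g: "\<And>z. g z = c + (\<Sum>(J, \<alpha>)\<in>{J. length J \<le> r} \<times> UNIV. b (J, \<alpha>) * z J $ \<alpha>)
      + (\<Sum>(J, \<alpha>)\<in>{J. length J \<le> r} \<times> UNIV. \<Sum>(K, \<beta>)\<in>{J. length J \<le> r} \<times> UNIV.
           a (J, \<alpha>) (K, \<beta>) * (z J $ \<alpha>) * (z K $ \<beta>))"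
    using assms(1) unfolding jet_poly_deg2_def Let_def by blast
  show ?thesis
    unfolding g using assms(2)
    by (intro arg_cong2[where f="(+)"] sum.cong refl) (auto intro!: sum.cong)
qed

text \<open>\<open>frechet_derivative\<close> is meaningful only where a function is differentiable,
  hence the bound on the order: to differentiate once more, the lower partials must be
  differentiable.\<close>

lemma partials_affine:
  assumes "open \<Omega>" and "Ck_on r \<Omega> u" and "Ck_on r \<Omega> w" and "length J \<le> r" and "x \<in> \<Omega>"
  shows "partials J (\<lambda>x. s *\<^sub>R u x + t *\<^sub>R w x) x = s *\<^sub>R partials J u x + t *\<^sub>R partials J w x"
  using assms(4,5)
proof (induction J arbitrary: x)
  case Nil
  show ?case by simp
next
  case (Cons i J)
  let ?S = "\<lambda>x. s *\<^sub>R partials J u x + t *\<^sub>R partials J w x"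
  let ?D = "\<lambda>h. s *\<^sub>R frechet_derivative (partials J u) (at x) h + t *\<^sub>R frechet_derivative (partials J w) (at x) h"
  have "partials J u differentiable (at x)" "partials J w differentiable (at x)"
    using Cons.prems assms(1-3)
    by (auto simp: Ck_on_def differentiable_on_eq_differentiable_at)
  then have "(?S has_derivative ?D) (at x)"
    by (intro has_derivative_add has_derivative_scaleR_right) (simp_all add: frechet_derivative_works[symmetric])
  \<comment> \<open>The induction hypothesis holds on all of the open set \<Omega>, a neighbourhood
    of \<open>x\<close>, so the derivative transfers from \<open>?S\<close>.\<close>
  then have "(partials J (\<lambda>x. s *\<^sub>R u x + t *\<^sub>R w x) has_derivative ?D) (at x)"
    by (rule has_derivative_transform_within_open[OF _ assms(1)])
      (use Cons in auto)
  then show ?case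
    by (simp add: partial_def frechet_derivative_at[symmetric])
qed

lemma quadratic_functional_density:
  assumes "open \<Omega>" and V: "admissible_states r \<Omega> V" and "x \<in> \<Omega>" and g: "jet_poly_deg2 r g"
  shows "quadratic_functional V (\<lambda>w. g (jet w x))"
proof -
  have sub: "field_subspace V" and Ck: "\<And>u. u \<in> V \<Longrightarrow> Ck_on r \<Omega> u"
    using V by (auto simp: admissible_states_def)
  obtain c l B where q: "\<And>z. g z = c + l z + B z z"
    and l: "\<And>z z' s t. l (\<lambda>J. s *\<^sub>R z J + t *\<^sub>R z' J) = s * l z + t * l z'"
    and B1: "\<And>z z' w s t. B (\<lambda>J. s *\<^sub>R z J + t *\<^sub>R z' J) w = s * B z w + t * B z' w"
    and B2: "\<And>z z' w s t. B w (\<lambda>J. s *\<^sub>R z J + t *\<^sub>R z' J) = s * B w z + t * B w z'"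
    using jet_poly_deg2_bilinear[OF g] by blast
  \<comment> \<open>Passes from jets of combinations to combinations of jets. The explicit scalars 1
    and -1 in \<open>quadratic_functional\<close> make its shifted fields instances of this
    shape.\<close>
  have two: "g (jet (\<lambda>x. u x + \<epsilon> *\<^sub>R \<phi> x) x)
      = g (\<lambda>J. 1 *\<^sub>R jet u x J + \<epsilon> *\<^sub>R jet \<phi> x J)" if "u \<in> V" "\<phi> \<in> V" for u \<phi> \<epsilon>
    using partials_affine[OF assms(1) Ck[OF that(1)] Ck[OF that(2)] _ assms(3), of _ 1 \<epsilon>]
    by (intro jet_poly_deg2_cong[OF g]) (simp add: jet_def)
  have three: "g (jet (\<lambda>x. ((1 - t) *\<^sub>R u x + t *\<^sub>R w x) + \<epsilon> *\<^sub>R \<phi> x) x)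
      = g (\<lambda>J. 1 *\<^sub>R ((1 - t) *\<^sub>R jet u x J + t *\<^sub>R jet w x J) + \<epsilon> *\<^sub>R jet \<phi> x J)"
    if "u \<in> V" "w \<in> V" "\<phi> \<in> V" for u w \<phi> \<epsilon> t
  proof (rule jet_poly_deg2_cong[OF g])
    fix J :: "'a list" assume J: "length J \<le> r"
    have m: "(\<lambda>x. (1 - t) *\<^sub>R u x + t *\<^sub>R w x) \<in> V"
      using sub that by (intro field_subspace_affine)
    show "jet (\<lambda>x. ((1 - t) *\<^sub>R u x + t *\<^sub>R w x) + \<epsilon> *\<^sub>R \<phi> x) x J
      = 1 *\<^sub>R ((1 - t) *\<^sub>R jet u x J + t *\<^sub>R jet w x J) + \<epsilon> *\<^sub>R jet \<phi> x J"
      using partials_affine[OF assms(1) Ck[OF m] Ck[OF that(3)] J assms(3), of 1 \<epsilon>]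
        partials_affine[OF assms(1) Ck[OF that(1)] Ck[OF that(2)] J assms(3), of "1 - t" t]
      by (simp add: jet_def)
  qed
  show ?thesis
    unfolding quadratic_functional_def
  proof (intro conjI ballI allI)
    fix u \<phi> \<epsilon> assume "u \<in> V" "\<phi> \<in> V"
    then show "g (jet (\<lambda>x. u x + \<epsilon> *\<^sub>R \<phi> x) x) = (1 - \<epsilon>\<^sup>2) * g (jet u x)
        + ((\<epsilon>\<^sup>2 + \<epsilon>) / 2) * g (jet (\<lambda>x. u x + 1 *\<^sub>R \<phi> x) x)
        + ((\<epsilon>\<^sup>2 - \<epsilon>) / 2) * g (jet (\<lambda>x. u x + (- 1) *\<^sub>R \<phi> x) x)"
      by (simp only: two, simp only: q l B1 B2) (simp add: field_simps power2_eq_square)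
  next
    \<comment> \<open>At a base jet \<open>m\<close> with direction \<open>p\<close>, the central
      difference is \<open>2 * l p + 2 * (B m p + B p m)\<close>: the constant and the even terms
      cancel, leaving an expression affine in \<open>m\<close>.\<close>
    fix u w \<phi> t assume "u \<in> V" "w \<in> V" "\<phi> \<in> V"
    then show "g (jet (\<lambda>x. ((1 - t) *\<^sub>R u x + t *\<^sub>R w x) + 1 *\<^sub>R \<phi> x) x)
        - g (jet (\<lambda>x. ((1 - t) *\<^sub>R u x + t *\<^sub>R w x) + (- 1) *\<^sub>R \<phi> x) x) =
        (1 - t) * (g (jet (\<lambda>x. u x + 1 *\<^sub>R \<phi> x) x) - g (jet (\<lambda>x. u x + (- 1) *\<^sub>R \<phi> x) x))
        + t * (g (jet (\<lambda>x. w x + 1 *\<^sub>R \<phi> x) x) - g (jet (\<lambda>x. w x + (- 1) *\<^sub>R \<phi> x) x))"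
      by (simp only: two three, simp only: q l B1 B2) (simp add: algebra_simps)
  qed
qed

lemma quadratic_functional_multi_functional_fst:
  assumes "open \<Omega>" and V: "admissible_states r \<Omega> V"
    and H: "polarised_hamiltonian r \<Omega> V k \<H> G" and "quadratic_in_each_argument r k G"
    and ts: "Suc (length ts) = k" "set ts \<subseteq> V"
  shows "quadratic_functional V (\<lambda>w. multi_functional \<Omega> G (w # ts))"
  unfolding multi_functional_def
proof (rule quadratic_functional_integral)
  show "\<Omega> \<in> sets lebesgue" using assms(1) by simp
  show "field_subspace V" using V by (simp add: admissible_states_def)
next
  fix x assume "x \<in> \<Omega>"
  \<comment> \<open>The hypothesis is phrased with list updates; \<open>undefined\<close> only fills
    position 0 and is overwritten at once.\<close>
  have "jet_poly_deg2 r (\<lambda>z. G ((undefined # map (\<lambda>w. jet w x) ts)[0 := z]))"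
    using assms(4) ts(1) unfolding quadratic_in_each_argument_def
    by (metis length_Cons length_map zero_less_Suc)
  then have "jet_poly_deg2 r (\<lambda>z. G (z # map (\<lambda>w. jet w x) ts))" by simp
  from quadratic_functional_density[OF assms(1) V \<open>x \<in> \<Omega>\<close> this]
  show "quadratic_functional V (\<lambda>w. G (map (\<lambda>w. jet w x) (w # ts)))" by simp
next
  fix w assume "w \<in> V"
  then have "length (w # ts) = k" "set (w # ts) \<subseteq> V" using ts by auto
  with H show "set_integrable lebesgue \<Omega> (\<lambda>x. G (map (\<lambda>w. jet w x) (w # ts)))"
    unfolding polarised_hamiltonian_def by blast
qed

subsection \<open>The scheme\<close>

theorem theorem4p5:
  fixes \<Omega> :: "(real ^ 'd::finite) set"
    and V Y :: "('d, 'm::finite) field set"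
    and r k :: nat
    and \<Delta>t :: real
    and \<G> :: "('d, 'm) jet \<Rightarrow> real"
    and G :: "('d, 'm) jet list \<Rightarrow> real"
    and \<D> :: "('d, 'm) field \<Rightarrow> ('d, 'm) field \<Rightarrow> ('d, 'm) field"
    and D :: "('d, 'm) field list \<Rightarrow> ('d, 'm) field \<Rightarrow> ('d, 'm) field"
  assumes "open \<Omega>"
    and "admissible_states r \<Omega> V"
    and "covector_space \<Omega> Y"
    and "hamiltonian_density r \<Omega> V \<G>"
    and "\<And>u. u \<in> V \<Longrightarrow> skew_symmetric_operator \<Omega> Y (\<D> u)"
    and "k \<ge> 1"
    and "polarised_hamiltonian r \<Omega> V k (hamiltonian \<Omega> \<G>) G"
    and "quadratic_in_each_argument r k G"
    and "variationally_differentiable_fst \<Omega> V Y k (multi_functional \<Omega> G)"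
    and "approximates_operator \<Omega> V Y k D \<D>"
    and "\<Delta>t > 0"
  shows "linearly_implicit \<Omega> V k
    (\<lambda>us U x. (U x - hd us x) /\<^sub>R (real k * \<Delta>t))
    (\<lambda>us U x. real k *\<^sub>R D (tl us) (avf_derivative \<Omega> V Y (multi_functional \<Omega> G) (us @ [U])) x)"
  unfolding linearly_implicit_def
proof (intro allI impI)
  fix us :: "('d, 'm) field list"
  assume us: "length us = k" "set us \<subseteq> V"
  \<comment> \<open>Since \<open>tl (butlast (us @ [U]))\<close> is \<open>tl us\<close>, the slots
    after the first hold known values, and the unknown enters the AVF derivative only through the
    first slot.\<close>
  define F where "F w = multi_functional \<Omega> G (w # tl us)" for w
  define \<delta> where "\<delta> w = variational_derivative \<Omega> V Y F w" for w
  have V: "field_subspace V" and Y: "field_subspace Y"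
    using assms(2,3) by (auto simp: admissible_states_def covector_space_def)
  have ne: "us \<noteq> []" using us(1) assms(6) by auto
  have ts: "Suc (length (tl us)) = k" "set (tl us) \<subseteq> V"
    using us ne by (cases us; auto)+
  have u0: "hd us \<in> V" using us(2) ne by auto
  have F: "quadratic_functional V F"
    unfolding F_def
    by (rule quadratic_functional_multi_functional_fst[OF assms(1,2,7,8) ts])
  have has: "has_variational_derivative \<Omega> V Y F w (\<delta> w)" if "w \<in> V" for w
  proof -
    have "length (w # tl us) = k" "set (w # tl us) \<subseteq> V" using ts that by auto
    with assms(9) obtain v where v: "has_variational_derivative \<Omega> V Y F w v"
      unfolding variationally_differentiable_fst_def F_def by (metis list.sel(1,3))
    with variational_derivative_eq[OF assms(1-3) v] show ?thesis by (simp add: \<delta>_def)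
  qed
  have \<delta>Y: "\<delta> w \<in> Y" if "w \<in> V" for w
    using has[OF that] by (simp add: has_variational_derivative_def)
  have \<delta>_affine: "\<delta> (\<lambda>x. (1 - t) *\<^sub>R u x + t *\<^sub>R w x) = (\<lambda>x. (1 - t) *\<^sub>R \<delta> u x + t *\<^sub>R \<delta> w x)"
    if "u \<in> V" "w \<in> V" for u w t
    unfolding \<delta>_def[of "\<lambda>x. (1 - t) *\<^sub>R u x + t *\<^sub>R w x"]
    by (rule variational_derivative_eq[OF assms(1-3)])
      (rule has_variational_derivative_affine[OF V Y F that has[OF that(1)] has[OF that(2)]])
  have zero: "(\<lambda>x. 0) \<in> V" using V by (simp add: field_subspace_def)
  \<comment> \<open>The linear part of the affine map \<delta>, obtained by subtracting its value at
    the zero field.\<close>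
  define M where "M w = (\<lambda>x. \<delta> w x - \<delta> (\<lambda>x. 0) x)" for w
  have MY: "M w \<in> Y" if "w \<in> V" for w
    using field_subspace_affine[OF Y \<delta>Y[OF that] \<delta>Y[OF zero], of 1 "-1"] by (simp add: M_def)
  have M_scale: "M (\<lambda>x. c *\<^sub>R w x) = (\<lambda>x. c *\<^sub>R M w x)" if "w \<in> V" for c w
    \<comment> \<open>A multiple \<open>c *\<^sub>R w\<close> is the affine combination of 0 and
      \<open>w\<close> with weight \<open>c\<close>.\<close>
    using \<delta>_affine[OF zero that, of c] by (simp add: M_def algebra_simps)
  have M_add: "M (\<lambda>x. u x + w x) = (\<lambda>x. M u x + M w x)" if "u \<in> V" "w \<in> V" for u w
  proof -
    \<comment> \<open>Additivity via the midpoint: \<delta> averages there, and homogeneity of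
      \<open>M\<close> restores the factor 2.\<close>
    let ?m = "\<lambda>x. (1 - 1 / 2) *\<^sub>R u x + (1 / 2 :: real) *\<^sub>R w x"
    have m: "?m \<in> V" using V that by (rule field_subspace_affine)
    have "(\<lambda>x. u x + w x) = (\<lambda>x. 2 *\<^sub>R ?m x)"
      by (simp add: algebra_simps flip: scaleR_add_left)
    then have "M (\<lambda>x. u x + w x) = (\<lambda>x. 2 *\<^sub>R M ?m x)"
      using M_scale[OF m] by simp
    also have "\<dots> = (\<lambda>x. M u x + M w x)"
      unfolding M_def \<delta>_affine[OF that] by (simp add: algebra_simps scaleR_2)
    finally show ?thesis .
  qed
  \<comment> \<open>The AVF derivative is the mean of \<delta> at \<open>hd us\<close> and at
    \<open>U\<close>; writing \<open>\<delta> U\<close> as \<open>M U\<close> plus \<delta> at zero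
    leaves \<open>w0\<close> as the part free of \<open>U\<close>.\<close>
  define w0 where "w0 = (\<lambda>x. \<delta> (hd us) x + \<delta> (\<lambda>x. 0) x)"
  have avf: "avf_derivative \<Omega> V Y (multi_functional \<Omega> G) (us @ [U]) =
      (\<lambda>x. (1 / 2) *\<^sub>R M U x + (1 / 2) *\<^sub>R w0 x)" if "U \<in> V" for U
  proof
    fix x
    have "variational_derivative_fst \<Omega> V Y (multi_functional \<Omega> G)
        ((\<lambda>y. \<xi> *\<^sub>R U y + (1 - \<xi>) *\<^sub>R hd us y) # tl us) x
        = \<delta> (hd us) x + \<xi> *\<^sub>R (\<delta> U x - \<delta> (hd us) x)" for \<xi>
      using fun_cong[OF \<delta>_affine[OF u0 that, of \<xi>], of x]
      by (simp add: variational_derivative_fst_def \<delta>_def F_def[abs_def] algebra_simps)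
    then have "avf_derivative \<Omega> V Y (multi_functional \<Omega> G) (us @ [U]) x =
        integral {0..1} (\<lambda>\<xi>. \<delta> (hd us) x + \<xi> *\<^sub>R (\<delta> U x - \<delta> (hd us) x))"
      using ne by (simp add: avf_derivative_def)
    \<comment> \<open>The endpoint values of the antiderivative, with coefficients \<xi> and
      \<open>\<xi>\<^sup>2 / 2\<close>, stay unsimplified to match the fundamental theorem.\<close>
    moreover have "((\<lambda>\<xi>. \<delta> (hd us) x + \<xi> *\<^sub>R (\<delta> U x - \<delta> (hd us) x)) has_integral
        (1 *\<^sub>R \<delta> (hd us) x + (1\<^sup>2 / 2) *\<^sub>R (\<delta> U x - \<delta> (hd us) x))
        - (0 *\<^sub>R \<delta> (hd us) x + (0\<^sup>2 / 2) *\<^sub>R (\<delta> U x - \<delta> (hd us) x))) {0..1::real}"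
      by (rule fundamental_theorem_of_calculus)
        (auto intro!: derivative_eq_intros)
    ultimately have avf_eq: "avf_derivative \<Omega> V Y (multi_functional \<Omega> G) (us @ [U]) x =
        \<delta> (hd us) x + (1 / 2) *\<^sub>R (\<delta> U x - \<delta> (hd us) x)"
      by (simp add: integral_unique)
    show "avf_derivative \<Omega> V Y (multi_functional \<Omega> G) (us @ [U]) x =
        (1 / 2) *\<^sub>R M U x + (1 / 2) *\<^sub>R w0 x"
      by (simp add: avf_eq M_def w0_def vec_eq_iff field_simps)
  qed
  have w0: "w0 \<in> Y"
    using Y \<delta>Y[OF u0] \<delta>Y[OF zero] unfolding w0_def field_subspace_def by blast
  \<comment> \<open>\<open>D\<close> receives \<open>tl us\<close>, which does not contain the
    unknown, so one fixed operator acts in the whole step. It is linear only on \<open>Y\<close>,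
    hence the membership facts for \<open>M\<close> and \<open>w0\<close>.\<close>
  have "linear_operator \<Omega> Y (D (tl us))"
    using assms(10) ts unfolding approximates_operator_def by auto
  then have D_add: "\<And>u v x. u \<in> Y \<Longrightarrow> v \<in> Y \<Longrightarrow> x \<in> \<Omega> \<Longrightarrow>
        D (tl us) (\<lambda>y. u y + v y) x = D (tl us) u x + D (tl us) v x"
    and D_scale: "\<And>c u x. u \<in> Y \<Longrightarrow> x \<in> \<Omega> \<Longrightarrow> D (tl us) (\<lambda>y. c *\<^sub>R u y) x = c *\<^sub>R D (tl us) u x"
    by (auto simp: linear_operator_def)
  have half: "(\<lambda>x. (1 / 2) *\<^sub>R w x) \<in> Y" if "w \<in> Y" for w
    using Y that unfolding field_subspace_def by blast
  \<comment> \<open>The coefficient \<open>real k / 2\<close> is the factor \<open>real k\<close> of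
    the scheme times the 1/2 of the mean; \<open>b\<close> collects everything determined by
    \<open>us\<close>.\<close>
  define L where "L U x = inverse (real k * \<Delta>t) *\<^sub>R U x - (real k / 2) *\<^sub>R D (tl us) (M U) x" for U x
  define b where "b x = - (inverse (real k * \<Delta>t) *\<^sub>R hd us x) - (real k / 2) *\<^sub>R D (tl us) w0 x" for x
  show "affine_operator \<Omega> V (\<lambda>U x. (U x - hd us x) /\<^sub>R (real k * \<Delta>t)
      - real k *\<^sub>R D (tl us) (avf_derivative \<Omega> V Y (multi_functional \<Omega> G) (us @ [U])) x)"
    unfolding affine_operator_def
  proof (intro exI conjI ballI)
    show "linear_operator \<Omega> V L"
      unfolding linear_operator_def L_def
      by (auto simp: M_add M_scale D_add D_scale MY algebra_simps)
  next
    fix U x assume "U \<in> V" "x \<in> \<Omega>"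
    then have "D (tl us) (avf_derivative \<Omega> V Y (multi_functional \<Omega> G) (us @ [U])) x
        = (1 / 2) *\<^sub>R D (tl us) (M U) x + (1 / 2) *\<^sub>R D (tl us) w0 x"
      using w0 unfolding avf[OF \<open>U \<in> V\<close>]
      by (simp add: D_add D_scale half MY)
    then show "(U x - hd us x) /\<^sub>R (real k * \<Delta>t)
      - real k *\<^sub>R D (tl us) (avf_derivative \<Omega> V Y (multi_functional \<Omega> G) (us @ [U])) x = L U x + b x"
      by (simp add: L_def b_def algebra_simps)
  qed
qed

end
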